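(* For any $x\in(0,1/2)$ the set $\Lambda(x)=\{\lambda\in(0,1/2]: x\in K_\lambda\}$ is a Cantor set with $\min\Lambda(x)=x$ and $\max\Lambda(x)=1/2$.
   Context: For $\lambda\in(0,1/2]$, $K_\lambda\subset\mathbb{R}$ is the self-similar set generated by the iterated function system $\{f_{\lambda,d}(x)=\lambda x+d(1-\lambda): d=0,1\}$, i.e. the unique nonempty compact set with $K_\lambda=f_{\lambda,0}(K_\lambda)\cup f_{\lambda,1}(K_\lambda)$; equivalently $K_\lambda=\{(1-\lambda)\sum_{n=1}^\infty i_n\lambda^{n-1}: i_n\in\{0,1\}\ \forall n\ge 1\}$. A set $F\subset\mathbb{R}$ is called a Cantor set if it is a non-empty compact set containing neither interior points nor isolated points. *)

theory Defs
  imports "HOL-Analysis.Analysis"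
begin

definition ifs :: "real \<Rightarrow> real \<Rightarrow> real \<Rightarrow> real" where
  "ifs l d x = l * x + d * (1 - l)"

text \<open>
  The definite description is well-defined for \<open>0 < l < 1\<close>: see \<open>attractor_exists_unique\<close> and
  \<open>selfsim_eq_series\<close> below. For other \<open>l\<close> the value is irrelevant.
\<close>

definition selfsim :: "real \<Rightarrow> real set" where
  "selfsim l = (THE K. K \<noteq> {} \<and> compact K \<and> K = ifs l 0 ` K \<union> ifs l 1 ` K)"

definition Lambda :: "real \<Rightarrow> real set" where
  "Lambda x = {l \<in> {0<..1/2}. x \<in> selfsim l}"

definition cantor_set :: "real set \<Rightarrow> bool" where
  "cantor_set F \<longleftrightarrow> F \<noteq> {} \<and> compact F \<and> interior F = {} \<and> (\<nexists>p. p isolated_in F)"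

definition code_set :: "real \<Rightarrow> real set" where
  "code_set l = {(1 - l) * (\<Sum>n. i n * l ^ n) | i. \<forall>n::nat. i n \<in> {0, 1}}"

lemma code_summable:
  fixes l :: real
  assumes "0 < l" "l < 1" "\<forall>n. i n \<in> {0, 1::real}"
  shows "summable (\<lambda>n. i n * l ^ n)"
proof (rule summable_comparison_test')
  show "summable (\<lambda>n. l ^ n)" using assms by (simp add: summable_geometric)
  show "norm (i n * l ^ n) \<le> l ^ n" for n
    using assms(3)[rule_format, of n] assms(1) by auto
qed

lemma code_set_bounds:
  assumes "0 < l" "l < 1" "y \<in> code_set l"
  shows "0 \<le> y" "y \<le> 1"
proof -
  obtain i where i: "\<forall>n. i n \<in> {0, 1::real}" and y: "y = (1 - l) * (\<Sum>n. i n * l ^ n)"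
    using assms(3) by (auto simp: code_set_def)
  have nn: "0 \<le> i n * l ^ n" "i n * l ^ n \<le> l ^ n" for n
    using i[rule_format, of n] assms(1) by auto
  have s: "summable (\<lambda>n. i n * l ^ n)" by (rule code_summable[OF assms(1,2) i])
  show "0 \<le> y" unfolding y using assms suminf_nonneg[OF s] nn by simp
  have "(\<Sum>n. i n * l ^ n) \<le> (\<Sum>n. l ^ n)"
    by (rule suminf_le[OF nn(2) s]) (use assms in \<open>simp add: summable_geometric\<close>)
  also have "\<dots> = 1 / (1 - l)" using assms by (simp add: suminf_geometric)
  finally show "y \<le> 1" unfolding y using assms by (simp add: field_simps)
qed

lemma code_set_invariant:
  assumes "0 < l" "l < 1"
  shows "code_set l = ifs l 0 ` code_set l \<union> ifs l 1 ` code_set l"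
proof -
  have split: "(1 - l) * (\<Sum>n. i n * l ^ n) = ifs l (i 0) ((1 - l) * (\<Sum>n. i (Suc n) * l ^ n))"
    if i: "\<forall>n. i n \<in> {0, 1::real}" for i
  proof -
    have s: "summable (\<lambda>n. i n * l ^ n)" by (rule code_summable[OF assms i])
    have t: "summable (\<lambda>n. i (Suc n) * l ^ n)"
      by (rule code_summable[OF assms]) (use i in blast)
    have "(\<Sum>n. i n * l ^ n) = i 0 + (\<Sum>n. i (Suc n) * l ^ Suc n)"
      using suminf_split_head[OF s] by simp
    also have "(\<Sum>n. i (Suc n) * l ^ Suc n) = l * (\<Sum>n. i (Suc n) * l ^ n)"
      using suminf_mult[OF t, of l] by (simp add: algebra_simps)
    finally show ?thesis by (simp add: ifs_def algebra_simps)
  qed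
  show ?thesis
  proof (intro equalityI subsetI)
    fix y assume "y \<in> code_set l"
    then obtain i where i: "\<forall>n. i n \<in> {0, 1::real}" and y: "y = (1 - l) * (\<Sum>n. i n * l ^ n)"
      by (auto simp: code_set_def)
    have "(1 - l) * (\<Sum>n. i (Suc n) * l ^ n) \<in> code_set l"
      unfolding code_set_def using i by (auto intro!: exI[of _ "\<lambda>n. i (Suc n)"])
    then show "y \<in> ifs l 0 ` code_set l \<union> ifs l 1 ` code_set l"
      unfolding y split[OF i] using i[rule_format, of 0] by auto
  next
    fix y assume "y \<in> ifs l 0 ` code_set l \<union> ifs l 1 ` code_set l"
    then obtain d z where d: "d \<in> {0, 1::real}" and z: "z \<in> code_set l" and y: "y = ifs l d z"
      by auto
    then obtain i where i: "\<forall>n. i n \<in> {0, 1::real}" and zi: "z = (1 - l) * (\<Sum>n. i n * l ^ n)"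
      by (auto simp: code_set_def)
    define j where "j = (\<lambda>n. case n of 0 \<Rightarrow> d | Suc m \<Rightarrow> i m)"
    have j: "\<forall>n. j n \<in> {0, 1}" using i d by (auto simp: j_def split: nat.split)
    have "y = (1 - l) * (\<Sum>n. j n * l ^ n)"
      unfolding split[OF j] y zi by (simp add: j_def)
    then show "y \<in> code_set l" unfolding code_set_def using j by blast
  qed
qed

lemma partial_code_tendsto:
  fixes l :: real
  assumes "0 < l" "l < 1" "\<forall>n. i n \<in> {0, 1::real}" "bounded (range z)"
  shows "(\<lambda>n. (1 - l) * (\<Sum>k<n. i k * l ^ k) + l ^ n * z n)
    \<longlonglongrightarrow> (1 - l) * (\<Sum>n. i n * l ^ n)"
proof -
  have a: "(\<lambda>n. \<Sum>k<n. i k * l ^ k) \<longlonglongrightarrow> (\<Sum>n. i n * l ^ n)"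
    by (rule summable_LIMSEQ[OF code_summable[OF assms(1-3)]])
  have "(\<lambda>n. l ^ n) \<longlonglongrightarrow> 0" using assms by (intro LIMSEQ_realpow_zero) auto
  moreover have "Bfun z sequentially"
    using assms(4) by (simp add: Bseq_eq_bounded)
  ultimately have "(\<lambda>n. l ^ n * z n) \<longlonglongrightarrow> 0"
    unfolding tendsto_Zfun_iff using bounded_bilinear.Zfun_prod_Bfun[OF bounded_bilinear_mult] by force
  from tendsto_add[OF tendsto_mult[OF tendsto_const a] this] show ?thesis by simp
qed

lemma attractor_eq_code_set:
  assumes l: "0 < l" "l < 1"
    and K: "K \<noteq> {}" "compact K" "K = ifs l 0 ` K \<union> ifs l 1 ` K"
  shows "K = code_set l"
proof (intro equalityI subsetI)
  fix y assume y: "y \<in> K"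
  have ex: "\<exists>d w. d \<in> {0, 1::real} \<and> w \<in> K \<and> v = ifs l d w" if "v \<in> K" for v
    using subsetD[OF equalityD1[OF K(3)] that] by blast
  then obtain D W where DW: "\<And>v. v \<in> K \<Longrightarrow> D v \<in> {0, 1::real} \<and> W v \<in> K \<and> v = ifs l (D v) (W v)"
    by metis
  define z where "z n = (W ^^ n) y" for n
  define i where "i n = D (z n)" for n
  have z: "z n \<in> K" for n by (induction n) (use y DW in \<open>auto simp: z_def\<close>)
  have i: "\<forall>n. i n \<in> {0, 1}" using DW z by (simp add: i_def)
  have eq: "y = (1 - l) * (\<Sum>k<n. i k * l ^ k) + l ^ n * z n" for n
  proof (induction n)
    case 0 show ?case by (simp add: z_def)
  next
    case (Suc n)
    have "z n = l * z (Suc n) + i n * (1 - l)"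
      using DW[OF z[of n]] by (simp add: i_def z_def ifs_def)
    with Suc show ?case by (simp add: algebra_simps)
  qed
  have "bounded (range z)"
    using z compact_imp_bounded[OF K(2)] by (meson bounded_subset image_subsetI)
  from partial_code_tendsto[OF l i this]
  have "(\<lambda>n::nat. y) \<longlonglongrightarrow> (1 - l) * (\<Sum>n. i n * l ^ n)" by (simp flip: eq)
  then have "y = (1 - l) * (\<Sum>n. i n * l ^ n)" by (simp add: LIMSEQ_const_iff)
  then show "y \<in> code_set l" unfolding code_set_def using i by blast
next
  fix y assume "y \<in> code_set l"
  then obtain i where i: "\<forall>n. i n \<in> {0, 1::real}" and y: "y = (1 - l) * (\<Sum>n. i n * l ^ n)"
    by (auto simp: code_set_def)
  obtain a where a: "a \<in> K" using K(1) by blast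
  have "ifs l 0 ` K \<subseteq> K" "ifs l 1 ` K \<subseteq> K" using equalityD2[OF K(3)] by simp_all
  then have sub: "ifs l d v \<in> K" if "d \<in> {0, 1}" "v \<in> K" for d v
    using that by fast
  have "\<forall>v\<in>K. (1 - l) * (\<Sum>k<n. i k * l ^ k) + l ^ n * v \<in> K" for n
  proof (induction n)
    case (Suc n)
    show ?case
    proof
      fix v assume "v \<in> K"
      then have "ifs l (i n) v \<in> K" by (rule sub[OF i[rule_format]])
      from Suc[rule_format, OF this]
      show "(1 - l) * (\<Sum>k<Suc n. i k * l ^ k) + l ^ Suc n * v \<in> K"
        by (simp add: ifs_def algebra_simps)
    qed
  qed simp
  then have "(1 - l) * (\<Sum>k<n. i k * l ^ k) + l ^ n * a \<in> K" for n using a by blast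
  moreover have "(\<lambda>n. (1 - l) * (\<Sum>k<n. i k * l ^ k) + l ^ n * a) \<longlonglongrightarrow> y"
    unfolding y by (rule partial_code_tendsto[OF l i]) simp
  ultimately show "y \<in> K"
    by (rule closed_sequentially[OF compact_imp_closed[OF K(2)]])
qed

lemma code_set_attractor:
  assumes l: "0 < l" "l < 1"
  shows "code_set l \<noteq> {}" "compact (code_set l)"
proof -
  show ne: "code_set l \<noteq> {}" by (auto simp: code_set_def intro!: exI[of _ "\<lambda>n. 0"])
  have "code_set l \<subseteq> {0..1}" using code_set_bounds[OF l] by auto
  then have b: "bounded (code_set l)" using bounded_closed_interval bounded_subset by blast
  let ?C = "closure (code_set l)"
  have cC: "compact ?C" using b by (simp add: compact_closure)
  have cont: "continuous_on S (ifs l d)" for S d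
    unfolding ifs_def by (intro continuous_intros)
  have im: "ifs l d ` ?C = closure (ifs l d ` code_set l)" for d
  proof
    show "ifs l d ` ?C \<subseteq> closure (ifs l d ` code_set l)"
      by (rule image_closure_subset[OF cont closed_closure closure_subset])
    have "closed (ifs l d ` ?C)"
      by (intro compact_imp_closed compact_continuous_image cont cC)
    then show "closure (ifs l d ` code_set l) \<subseteq> ifs l d ` ?C"
      by (intro closure_minimal image_mono closure_subset)
  qed
  have "?C = closure (ifs l 0 ` code_set l \<union> ifs l 1 ` code_set l)"
    by (rule arg_cong[OF code_set_invariant[OF l]])
  also have "\<dots> = ifs l 0 ` ?C \<union> ifs l 1 ` ?C" by (simp only: im closure_Un)
  finally have "?C = code_set l"
    using ne cC by (intro attractor_eq_code_set[OF l]) (simp_all only: closure_eq_empty not_False_eq_True)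
  with cC show "compact (code_set l)" by simp
qed

lemma attractor_exists_unique:
  assumes "0 < l" "l < 1"
  shows "\<exists>!K. K \<noteq> {} \<and> compact K \<and> K = ifs l 0 ` K \<union> ifs l 1 ` K"
proof (rule ex1I)
  show "code_set l \<noteq> {} \<and> compact (code_set l) \<and> code_set l = ifs l 0 ` code_set l \<union> ifs l 1 ` code_set l"
    by (intro conjI code_set_attractor code_set_invariant assms)
next
  fix K assume "K \<noteq> {} \<and> compact K \<and> K = ifs l 0 ` K \<union> ifs l 1 ` K"
  then show "K = code_set l" by (elim conjE) (rule attractor_eq_code_set[OF assms])
qed

lemma selfsim_eq_series:
  assumes "0 < l" "l < 1"
  shows "selfsim l = {(1 - l) * (\<Sum>n. i n * l ^ n) | i. \<forall>n::nat. i n \<in> {0, 1}}"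
proof -
  have "selfsim l = code_set l"
    using theI'[OF attractor_exists_unique[OF assms], folded selfsim_def]
    by (elim conjE) (rule attractor_eq_code_set[OF assms])
  then show ?thesis by (simp only: code_set_def)
qed

end

theory Submission
  imports Defs
begin

text \<open>
  For \<open>0 < l < 1\<close> the points of the self-similar set are the values \<open>(1 - l) * (\<Sum>n\<in>A. l ^ n)\<close>, where
  the set \<open>A\<close> of natural numbers lists the positions of the digit 1. For \<open>x < 1/2\<close> and
  \<open>l \<le> 1/2\<close>, position 0 cannot carry the digit 1, since that alone contributes \<open>1 - l \<ge> 1/2\<close>. Every
  other weight \<open>(1 - l) * l ^ n\<close> with \<open>n > 0\<close> strictly increases with \<open>l\<close> on \<open>(0, 1/2]\<close>. Hence
  a fixed code \<open>A\<close> yields the value \<open>x\<close> for at most one parameter \<open>l\<close> (\<open>coded_strict_mono\<close>), and the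
  intermediate value theorem locates that parameter.

  Compactness: \<open>x\<close> lies in the self-similar set iff for each \<open>n\<close> it lies in one of the
  \<open>2 ^ n\<close> basic intervals of length \<open>l ^ n\<close>, and each of the \<open>2 ^ n\<close> alternatives is a closed
  condition on \<open>l\<close>.

  No isolated points: changing a code only at far positions changes its values little, near any
  given parameter, so by monotonicity the changed code still attains \<open>x\<close> at a parameter close to
  the old one. It is a different parameter because the new code has a different value at the old
  one. Below \<open>1/2\<close> one flips a single far digit. At \<open>1/2\<close> the value must go up, since a solution
  above \<open>1/2\<close> is of no use; this is achieved by cutting the binary expansion of \<open>x\<close> and
  continuing with the digit 1 forever.

  Empty interior: suppose every \<open>l\<close> in an interval below \<open>1/2\<close> belongs to the set. Among
  the codes with given first \<open>n\<close> digits, those with next digit 0 and those with next digit 1 have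
  their values on different sides of the midpoint of a gap, which moves continuously with \<open>l\<close>.
  As \<open>x\<close> is never equal to the midpoint, it stays on one side, so inductively all digits of
  the code of \<open>x\<close> are constant on the interval (\<open>digits_constant_on_interval\<close>). This contradicts
  strict monotonicity.
\<close>

section \<open>Points of the self-similar set and their codes\<close>

definition coded :: "nat set \<Rightarrow> real \<Rightarrow> real" where
  "coded A l = (1 - l) * (\<Sum>n. indicat_real A n * l ^ n)"

definition partial_coded :: "nat set \<Rightarrow> nat \<Rightarrow> real \<Rightarrow> real" where
  "partial_coded A n l = (1 - l) * (\<Sum>k<n. indicat_real A k * l ^ k)"

lemma selfsim_eq_range_coded:
  assumes "0 < l" "l < 1"
  shows "selfsim l = range (\<lambda>A. coded A l)"
proof -
  have "\<exists>A. i = indicat_real A" if "\<forall>n. i n \<in> {0, 1::real}" for i :: "nat \<Rightarrow> real"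
    using that by (intro exI[of _ "{n. i n = 1}"]) (auto simp: fun_eq_iff indicator_def)
  moreover have "\<forall>n. indicat_real A n \<in> {0, 1}" for A :: "nat set"
    by (simp add: indicator_def)
  ultimately show ?thesis
    unfolding selfsim_eq_series[OF assms] coded_def by blast
qed

lemma indicator_power_summable:
  fixes l :: real
  assumes "0 < l" "l < 1"
  shows "summable (\<lambda>n. indicat_real A n * l ^ n)"
  by (rule code_summable[OF assms]) (simp add: indicator_def)

lemma coded_nonneg_le_1:
  assumes "0 < l" "l < 1"
  shows "0 \<le> coded A l" "coded A l \<le> 1"
proof -
  have "coded A l \<in> code_set l"
    unfolding code_set_def coded_def by (auto simp: indicator_def intro!: exI[of _ "indicat_real A"])
  then show "0 \<le> coded A l" "coded A l \<le> 1"
    using code_set_bounds[OF assms] by auto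
qed

text \<open>
  The tail of a code is again a code, with value in \<open>[0, 1]\<close>; thus \<open>partial_coded A n l\<close> and
  \<open>partial_coded A n l + l ^ n\<close> are the endpoints of the basic interval of the first \<open>n\<close> digits.
\<close>

lemma coded_split:
  assumes "0 < l" "l < 1"
  shows "coded A l = partial_coded A n l + l ^ n * coded {k. k + n \<in> A} l"
proof -
  let ?B = "{k. k + n \<in> A}"
  have "(\<Sum>k. indicat_real A k * l ^ k)
      = (\<Sum>k. indicat_real A (k + n) * l ^ (k + n)) + (\<Sum>k<n. indicat_real A k * l ^ k)"
    by (rule suminf_split_initial_segment[OF indicator_power_summable[OF assms]])
  also have "(\<lambda>k. indicat_real A (k + n) * l ^ (k + n)) = (\<lambda>k. l ^ n * (indicat_real ?B k * l ^ k))"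
    by (auto simp: fun_eq_iff power_add indicator_def)
  also have "(\<Sum>k. l ^ n * (indicat_real ?B k * l ^ k)) = l ^ n * (\<Sum>k. indicat_real ?B k * l ^ k)"
    by (rule suminf_mult[OF indicator_power_summable[OF assms]])
  finally show ?thesis
    by (simp add: coded_def partial_coded_def algebra_simps)
qed

lemma coded_bounds:
  assumes "0 < l" "l < 1"
  shows "partial_coded A n l \<le> coded A l" "coded A l \<le> partial_coded A n l + l ^ n"
  using coded_split[OF assms, of A n] coded_nonneg_le_1[OF assms, of "{k. k + n \<in> A}"] assms
  by (simp_all add: mult_left_le)

lemma partial_coded_cong:
  assumes "A \<inter> {..<n} = B \<inter> {..<n}"
  shows "partial_coded A n l = partial_coded B n l"
proof -
  have "indicat_real A k = indicat_real B k" if "k < n" for k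
    using assms that by (auto simp: indicator_def)
  then show ?thesis by (simp add: partial_coded_def)
qed

lemma partial_coded_Suc:
  "partial_coded A (Suc n) l = partial_coded A n l + (if n \<in> A then (1 - l) * l ^ n else 0)"
  by (simp add: partial_coded_def algebra_simps)

lemma coded_close:
  assumes "0 < l" "l < 1" "A \<inter> {..<n} = B \<inter> {..<n}"
  shows "\<bar>coded A l - coded B l\<bar> \<le> l ^ n"
  using coded_bounds[OF assms(1,2), of A n] coded_bounds[OF assms(1,2), of B n]
    partial_coded_cong[OF assms(3), of l] by linarith

lemma coded_UNIV: "0 < l \<Longrightarrow> l < 1 \<Longrightarrow> coded UNIV l = 1"
  by (simp add: coded_def suminf_geometric)

lemma coded_finite_prefix:
  assumes "0 < l" "l < 1"
  shows "coded (A \<inter> {..<n}) l = partial_coded A n l"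
proof -
  have "{k. k + n \<in> A \<inter> {..<n}} = {}" by auto
  moreover have "coded {} l = 0" by (simp add: coded_def)
  ultimately show ?thesis
    using coded_split[OF assms, of "A \<inter> {..<n}" n] partial_coded_cong[of "A \<inter> {..<n}" n A l]
    by simp
qed

lemma coded_prefix_ones:
  assumes "0 < l" "l < 1"
  shows "coded (A \<inter> {..<n} \<union> {n..}) l = partial_coded A n l + l ^ n"
proof -
  let ?B = "A \<inter> {..<n} \<union> {n..}"
  have "{k. k + n \<in> ?B} = UNIV" by auto
  moreover have "partial_coded ?B n l = partial_coded A n l"
    by (rule partial_coded_cong) auto
  ultimately show ?thesis
    using coded_split[OF assms, of ?B n] coded_UNIV[OF assms] by simp
qed

section \<open>Dependence of a value on the parameter and on the code\<close>

text \<open>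
  The factor \<open>l * (1 - l)\<close> increases up to its maximum at \<open>1/2\<close>. The weight with \<open>n = 0\<close> is
  \<open>1 - l\<close>, which decreases.
\<close>

lemma weight_strict_mono:
  fixes l m :: real
  assumes "0 < l" "l < m" "m \<le> 1/2" "0 < n"
  shows "(1 - l) * l ^ n < (1 - m) * m ^ n"
proof -
  obtain k where n: "n = Suc k" using assms(4) gr0_conv_Suc by blast
  have "0 < (m - l) * (1 - m - l)" using assms by (intro mult_pos_pos) auto
  then have "(1 - l) * l < (1 - m) * m" by (simp add: algebra_simps)
  moreover have "l ^ k \<le> m ^ k" using assms by (intro power_mono) auto
  moreover have "0 \<le> (1 - l) * l" "0 < l ^ k" using assms by simp_all
  ultimately have "(1 - l) * l * l ^ k < (1 - m) * m * m ^ k"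
    by (rule mult_less_le_imp_less)
  then show ?thesis by (simp add: n mult.assoc)
qed

lemma coded_strict_mono:
  assumes "0 < l" "l < m" "m \<le> 1/2" "0 \<notin> A" "A \<noteq> {}"
  shows "coded A l < coded A m"
proof -
  let ?f = "\<lambda>l n. (1 - l) * (indicat_real A n * l ^ n)"
  have l: "0 < l" "l < 1" and m: "0 < m" "m < 1" using assms by auto
  have s: "summable (?f l)" "summable (?f m)"
    by (intro summable_mult indicator_power_summable l m)+
  obtain n where n: "n \<in> A" "0 < n" using assms(4,5) by (metis ex_in_conv gr0I)
  have less: "(1 - l) * l ^ k < (1 - m) * m ^ k" if "k \<in> A" for k
    using that assms by (intro weight_strict_mono) (auto intro: gr0I)
  have "0 < (\<Sum>n. ?f m n - ?f l n)"
  proof (rule suminf_pos2)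
    show "summable (\<lambda>n. ?f m n - ?f l n)" by (intro summable_diff s)
    show "0 \<le> ?f m k - ?f l k" for k using less[of k] by (cases "k \<in> A") auto
    show "0 < ?f m n - ?f l n" using less[OF n(1)] n by simp
  qed
  also have "\<dots> = coded A m - coded A l"
    unfolding coded_def
    by (simp add: suminf_diff[OF s(2) s(1), symmetric] suminf_mult indicator_power_summable l m)
  finally show ?thesis by simp
qed

lemma isCont_coded:
  assumes "0 < l" "l < 1"
  shows "isCont (coded A) l"
proof -
  have "isCont (\<lambda>l. \<Sum>n. indicat_real A n * l ^ n) l"
    by (rule isCont_powser[where K = "(1 + l) / 2"])
      (use assms in \<open>auto intro: indicator_power_summable\<close>)
  then show ?thesis
    unfolding coded_def[abs_def] by (intro continuous_intros)
qed

text \<open>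
  For \<open>l < 1/2\<close> the two basic subintervals of a basic interval are separated by a gap, around the
  midpoint of the basic interval. Naming this midpoint rather than only comparing the two values
  provides the function that \<open>x\<close> cannot cross in \<open>digits_constant_on_interval\<close>.
\<close>

lemma coded_less_of_first_difference:
  assumes "0 < l" "l < 1/2" "A \<inter> {..<n} = B \<inter> {..<n}" "n \<notin> A" "n \<in> B"
  shows "coded A l < partial_coded B n l + l ^ n / 2" "partial_coded B n l + l ^ n / 2 < coded B l"
proof -
  have l: "0 < l" "l < 1" using assms by auto
  have p: "l * l ^ n < l ^ n / 2" using assms by simp
  show "coded A l < partial_coded B n l + l ^ n / 2"
    using coded_bounds(2)[OF l, of A "Suc n"] partial_coded_Suc[of A n l]
      partial_coded_cong[OF assms(3), of l] p assms(4) by simp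
  show "partial_coded B n l + l ^ n / 2 < coded B l"
    using coded_bounds(1)[OF l, of B "Suc n"] partial_coded_Suc[of B n l] p assms(5)
    by (simp add: algebra_simps)
qed

section \<open>Parameters at which a code attains the given value\<close>

lemma Lambda_iff_coded:
  "l \<in> Lambda x \<longleftrightarrow> 0 < l \<and> l \<le> 1/2 \<and> (\<exists>A. coded A l = x)"
  by (auto simp: Lambda_def selfsim_eq_range_coded)

lemma first_digit_zero:
  assumes "0 < l" "l \<le> 1/2" "coded A l < 1/2"
  shows "0 \<notin> A"
proof
  assume "0 \<in> A"
  then have "1 - l \<le> coded A l"
    using coded_bounds(1)[of l A "Suc 0"] assms by (simp add: partial_coded_def)
  then show False using assms by simp
qed

lemma coded_le_of_first_digit_zero:
  assumes "0 < l" "l < 1" "0 \<notin> A"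
  shows "coded A l \<le> l"
  using coded_bounds(2)[of l A "Suc 0"] assms by (simp add: partial_coded_def)

lemma nonempty_code:
  assumes "0 < coded A l"
  shows "A \<noteq> {}"
  using assms by (auto simp: coded_def)

lemma ex_Lambda_between:
  assumes "0 < l" "l < m" "m \<le> 1/2" "coded A l < x" "x < coded A m"
  shows "\<exists>k\<in>Lambda x. l < k \<and> k < m \<and> coded A k = x"
proof -
  have "\<exists>k. l \<le> k \<and> k \<le> m \<and> coded A k = x"
    by (rule IVT) (use assms in \<open>auto intro: isCont_coded\<close>)
  then obtain k where k: "l \<le> k" "k \<le> m" "coded A k = x" by blast
  then have lm: "l < k" "k < m" using assms by (auto simp: order_less_le)
  moreover have "k \<in> Lambda x" unfolding Lambda_iff_coded using k lm assms by auto
  ultimately show ?thesis using k by blast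
qed

section \<open>Binary expansions\<close>

definition binary_digits :: "real \<Rightarrow> nat set" where
  "binary_digits x = {n. odd \<lfloor>2 ^ Suc n * x\<rfloor>}"

lemma floor_double:
  fixes y :: real
  shows "\<lfloor>2 * y\<rfloor> = 2 * \<lfloor>y\<rfloor> + (if odd \<lfloor>2 * y\<rfloor> then 1 else 0)"
proof -
  have "\<lfloor>2 * y\<rfloor> = 2 * \<lfloor>y\<rfloor> \<or> \<lfloor>2 * y\<rfloor> = 2 * \<lfloor>y\<rfloor> + 1" by linarith
  then show ?thesis by auto
qed

lemma partial_binary_digits:
  assumes "0 \<le> x" "x < 1"
  shows "partial_coded (binary_digits x) n (1/2) = \<lfloor>2 ^ n * x\<rfloor> / 2 ^ n"
proof (induction n)
  case 0
  have "\<lfloor>x\<rfloor> = 0" using assms by linarith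
  then show ?case by (simp add: partial_coded_def)
next
  case (Suc n)
  have "real_of_int \<lfloor>2 ^ Suc n * x\<rfloor>
      = 2 * real_of_int \<lfloor>2 ^ n * x\<rfloor> + (if n \<in> binary_digits x then 1 else 0)"
    using arg_cong[OF floor_double[of "2 ^ n * x"], of real_of_int]
    by (simp add: binary_digits_def mult.assoc)
  then show ?case unfolding partial_coded_Suc Suc by (simp add: field_simps)
qed

lemma partial_binary_bounds:
  assumes "0 \<le> x" "x < 1"
  shows "partial_coded (binary_digits x) n (1/2) \<le> x"
    "x < partial_coded (binary_digits x) n (1/2) + (1/2) ^ n"
proof -
  have "real_of_int \<lfloor>2 ^ n * x\<rfloor> \<le> 2 ^ n * x" "2 ^ n * x < real_of_int \<lfloor>2 ^ n * x\<rfloor> + 1" by linarith+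
  then show "partial_coded (binary_digits x) n (1/2) \<le> x"
    "x < partial_coded (binary_digits x) n (1/2) + (1/2) ^ n"
    unfolding partial_binary_digits[OF assms] by (simp_all add: field_simps)
qed

lemma coded_binary_digits:
  assumes "0 \<le> x" "x < 1"
  shows "coded (binary_digits x) (1/2) = x"
proof (rule ccontr)
  assume "coded (binary_digits x) (1/2) \<noteq> x"
  then obtain n where "(1/2) ^ n < \<bar>coded (binary_digits x) (1/2) - x\<bar>"
    using real_arch_pow_inv[of "\<bar>coded (binary_digits x) (1/2) - x\<bar>" "1/2"] by auto
  then show False
    using coded_bounds[of "1/2" "binary_digits x" n] partial_binary_bounds[OF assms, of n] by auto
qed

section \<open>Extreme elements and compactness\<close>

lemma half_in_Lambda:
  assumes "0 < x" "x < 1/2"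
  shows "1/2 \<in> Lambda x"
  using coded_binary_digits[of x] assms by (auto simp: Lambda_iff_coded)

lemma self_in_Lambda:
  assumes "0 < x" "x < 1/2"
  shows "x \<in> Lambda x"
proof -
  \<comment> \<open>The digit sequence 0111... has value \<open>l\<close> at every parameter \<open>l\<close>.\<close>
  have "coded ({} \<inter> {..<1} \<union> {1..}) x = x"
    using coded_prefix_ones[of x "{}" 1] assms by (simp add: partial_coded_def)
  then show ?thesis using assms by (auto simp: Lambda_iff_coded)
qed

lemma Lambda_lower_bound:
  assumes "x < 1/2" "l \<in> Lambda x"
  shows "x \<le> l"
proof -
  obtain A where "0 < l" "l \<le> 1/2" "coded A l = x" using assms(2) by (auto simp: Lambda_iff_coded)
  then show ?thesis
    using first_digit_zero[of l A] coded_le_of_first_digit_zero[of l A] assms(1) by auto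
qed

text \<open>
  Approximating codes may disagree for different \<open>n\<close>. That they can nevertheless be replaced by
  one infinite code follows from the closedness of the self-similar set, as the left endpoints of
  the basic intervals belong to it. The benefit is that the right-hand side involves, for each
  \<open>n\<close>, only finitely many polynomials in \<open>l\<close>.
\<close>

lemma ex_coded_iff_approx:
  assumes "0 < l" "l < 1"
  shows "(\<exists>A. coded A l = x) \<longleftrightarrow>
    (\<forall>n. \<exists>A\<in>Pow {..<n}. partial_coded A n l \<le> x \<and> x \<le> partial_coded A n l + l ^ n)"
proof (intro iffI allI)
  fix n assume "\<exists>A. coded A l = x"
  then obtain A where A: "coded A l = x" by blast
  have "partial_coded (A \<inter> {..<n}) n l = partial_coded A n l"
    by (rule partial_coded_cong) auto
  then show "\<exists>A\<in>Pow {..<n}. partial_coded A n l \<le> x \<and> x \<le> partial_coded A n l + l ^ n"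
    using coded_bounds[OF assms, of A n] A by (intro bexI[of _ "A \<inter> {..<n}"]) auto
next
  assume "\<forall>n. \<exists>A\<in>Pow {..<n}. partial_coded A n l \<le> x \<and> x \<le> partial_coded A n l + l ^ n"
  then obtain A where A: "\<And>n. partial_coded (A n) n l \<le> x \<and> x \<le> partial_coded (A n) n l + l ^ n"
    by metis
  have "x \<in> closure (range (\<lambda>A. coded A l))"
    unfolding closure_approachable
  proof (intro allI impI)
    fix e :: real assume "0 < e"
    then obtain n where "l ^ n < e" using real_arch_pow_inv[OF _ assms(2)] by blast
    then have "dist (coded (A n \<inter> {..<n}) l) x < e"
      using A[of n] by (simp add: coded_finite_prefix[OF assms] dist_real_def)
    then show "\<exists>y\<in>range (\<lambda>A. coded A l). dist y x < e" by blast
  qed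
  moreover have "closed (range (\<lambda>A. coded A l))"
  proof -
    have "range (\<lambda>A. coded A l) = code_set l"
      using selfsim_eq_range_coded[OF assms] selfsim_eq_series[OF assms] by (simp add: code_set_def)
    then show ?thesis using code_set_attractor(2)[OF assms] by (simp add: compact_imp_closed)
  qed
  ultimately show "\<exists>A. coded A l = x" by auto
qed

lemma compact_Lambda:
  assumes "0 < x" "x < 1/2"
  shows "compact (Lambda x)"
proof -
  let ?C = "\<lambda>n A. {l. partial_coded A n l \<le> x \<and> x \<le> partial_coded A n l + l ^ n}"
  have "Lambda x = {x..1/2} \<inter> (\<Inter>n. \<Union>A\<in>Pow {..<n}. ?C n A)" (is "_ = ?R")
  proof (rule set_eqI)
    fix l
    show "l \<in> Lambda x \<longleftrightarrow> l \<in> ?R"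
    proof (cases "x \<le> l \<and> l \<le> 1/2")
      case True
      then have "0 < l" "l < 1" using assms by auto
      from ex_coded_iff_approx[OF this, of x] show ?thesis
        using True \<open>0 < l\<close> by (simp add: Lambda_iff_coded)
    next
      case False
      then show ?thesis
        using Lambda_lower_bound[OF assms(2), of l] by (auto simp: Lambda_iff_coded)
    qed
  qed
  moreover have "closed (?C n A)" for n A
    unfolding partial_coded_def by (intro closed_Collect_conj closed_Collect_le continuous_intros)
  ultimately show ?thesis
    by (simp add: compact_Int_closed closed_INT closed_UN)
qed

section \<open>Absence of isolated points\<close>

text \<open>
  Flipping the digit at a far position \<open>n\<close> moves the parameter that solves for \<open>x\<close> by an
  arbitrarily small nonzero amount. The room above \<open>l\<close> matters: depending on the digit flipped, the
  new solution lies to the left or to the right of \<open>l\<close>.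
\<close>

lemma Lambda_accumulates_below_half:
  assumes x: "0 < x" "x < 1/2" and l: "l \<in> Lambda x" "l < 1/2" and "0 < e"
  shows "\<exists>m\<in>Lambda x. m \<noteq> l \<and> dist m l < e"
proof -
  obtain A where A: "0 < l" "coded A l = x" using l(1) by (auto simp: Lambda_iff_coded)
  have A0: "0 \<notin> A" "A \<noteq> {}"
    using first_digit_zero[of l A] nonempty_code[of A l] A l x by auto
  define a where "a = max (l / 2) (l - e / 2)"
  define b where "b = min (1/2) (l + e / 2)"
  have ab: "0 < a" "a < l" "l < b" "b \<le> 1/2" "l - e < a" "b < l + e"
    unfolding a_def b_def using A(1) l(2) \<open>0 < e\<close> by linarith+
  have s: "coded A a < x" "x < coded A b"
    using coded_strict_mono[of a l A] coded_strict_mono[of l b A] ab A A0 by auto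
  \<comment> \<open>Changes at positions \<open>\<ge> n\<close> must preserve both strict inequalities; as \<open>a < b\<close>,
    smallness of \<open>b ^ n\<close> serves both ends.\<close>
  obtain n where n: "b ^ n < min (x - coded A a) (coded A b - x)"
    using real_arch_pow_inv[of "min (x - coded A a) (coded A b - x)" b] ab s by auto
  have "a ^ n \<le> b ^ n" using ab by (intro power_mono) auto
  define B where "B = (if n \<in> A then A - {n} else insert n A)"
  have AB: "A \<inter> {..<n} = B \<inter> {..<n}" by (auto simp: B_def)
  have "\<bar>coded A a - coded B a\<bar> \<le> a ^ n" "\<bar>coded A b - coded B b\<bar> \<le> b ^ n"
    using coded_close[of a A n B] coded_close[of b A n B] AB ab by simp_all
  then have "coded B a < x" "x < coded B b"
    using n \<open>a ^ n \<le> b ^ n\<close> by linarith+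
  then obtain m where m: "m \<in> Lambda x" "a < m" "m < b" "coded B m = x"
    using ex_Lambda_between[of a b B x] ab by auto
  have "coded B l \<noteq> coded A l"
  proof (cases "n \<in> A")
    case True
    then have "n \<notin> B" by (simp add: B_def)
    from coded_less_of_first_difference[OF A(1) l(2) AB[symmetric] this True] show ?thesis
      by linarith
  next
    case False
    then have "n \<in> B" by (simp add: B_def)
    from coded_less_of_first_difference[OF A(1) l(2) AB False this] show ?thesis
      by linarith
  qed
  then have "m \<noteq> l" using m(4) A(2) by auto
  then show ?thesis using m ab by (intro bexI[of _ m]) (auto simp: dist_real_def)
qed

text \<open>
  Solutions must now lie to the left of \<open>1/2\<close>, so the value at \<open>1/2\<close> has to be raised strictly
  above \<open>x\<close>. Replacing a tail of the code by ones does this for the expansion computed by the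
  floor function, because its truncation error is strictly below \<open>(1/2) ^ n\<close>.
\<close>

lemma Lambda_accumulates_at_half:
  assumes x: "0 < x" "x < 1/2" and "0 < e"
  shows "\<exists>m\<in>Lambda x. m \<noteq> 1/2 \<and> dist m (1/2) < e"
proof -
  define A where "A = binary_digits x"
  have A: "coded A (1/2) = x" using coded_binary_digits[of x] x by (simp add: A_def)
  have A0: "0 \<notin> A" "A \<noteq> {}"
    using first_digit_zero[of "1/2" A] nonempty_code[of A "1/2"] A x by auto
  define a where "a = max (1/4) (1/2 - e / 2)"
  have a: "0 < a" "a < 1/2" "1/2 - e < a" unfolding a_def using \<open>0 < e\<close> by linarith+
  have s: "coded A a < x" using coded_strict_mono[of a "1/2" A] a A A0 by auto
  obtain n where n: "a ^ n < x - coded A a"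
    using real_arch_pow_inv[of "x - coded A a" a] a s by auto
  define B where "B = A \<inter> {..<n} \<union> {n..}"
  have "A \<inter> {..<n} = B \<inter> {..<n}" by (auto simp: B_def)
  then have "coded B a < x" using coded_close[of a A n B] n a by auto
  moreover have "x < coded B (1/2)"
    using coded_prefix_ones[of "1/2" A n] partial_binary_bounds(2)[of x n] x
    by (simp add: A_def B_def)
  ultimately obtain m where "m \<in> Lambda x" "a < m" "m < 1/2"
    using ex_Lambda_between[of a "1/2" B x] a by auto
  then show ?thesis using a by (intro bexI[of _ m]) (auto simp: dist_real_def)
qed

lemma Lambda_no_isolated:
  assumes "0 < x" "x < 1/2"
  shows "\<not> p isolated_in Lambda x"
proof
  assume "p isolated_in Lambda x"
  then obtain e where p: "p \<in> Lambda x" and e: "0 < e" "\<And>m. m \<in> Lambda x \<Longrightarrow> dist p m < e \<Longrightarrow> m = p"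
    unfolding isolated_in_dist_Ex_iff by blast
  have "\<exists>m\<in>Lambda x. m \<noteq> p \<and> dist m p < e"
  proof (cases "p < 1/2")
    case True
    then show ?thesis using Lambda_accumulates_below_half[OF assms p _ e(1)] by blast
  next
    case False
    then have "p = 1/2" using p by (simp add: Lambda_iff_coded)
    then show ?thesis using Lambda_accumulates_at_half[OF assms e(1)] by (simp only:)
  qed
  then show False using e(2) by (metis dist_commute)
qed

section \<open>Empty interior\<close>

text \<open>
  Once the first \<open>n\<close> digits are known to be constant, the midpoint of their basic interval is
  one continuous function of the parameter, and the next digit tells on which side of it \<open>x\<close> lies.
\<close>

lemma digits_constant_on_interval:
  assumes ab: "0 < a" "b < 1/2"
    and c: "\<And>l. l \<in> {a..b} \<Longrightarrow> coded (c l) l = x"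
    and lm: "l \<in> {a..b}" "m \<in> {a..b}"
  shows "n \<in> c l \<longleftrightarrow> n \<in> c m"
  using lm
proof (induction n arbitrary: l m rule: less_induct)
  case (less n)
  let ?g = "\<lambda>k. partial_coded (c l) n k + k ^ n / 2"
  have pos: "0 < k" "k < 1/2" if "k \<in> {a..b}" for k using that ab by auto
  have below: "x < ?g k" if k: "k \<in> {a..b}" "n \<notin> c k" for k
  proof -
    \<comment> \<open>Inserting \<open>n\<close> provides a code with digit 1 at \<open>n\<close> to compare \<open>c k\<close> with;
      the midpoint depends only on the digits before \<open>n\<close>.\<close>
    have "c k \<inter> {..<n} = insert n (c l) \<inter> {..<n}"
      using less.IH[OF _ k(1) less.prems(1)] by auto
    from coded_less_of_first_difference(1)[OF pos[OF k(1)] this k(2)]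
    show ?thesis
      using c[OF k(1)] partial_coded_cong[of "insert n (c l)" n "c l" k] by simp
  qed
  have above: "?g k < x" if k: "k \<in> {a..b}" "n \<in> c k" for k
  proof -
    have "(c k - {n}) \<inter> {..<n} = c k \<inter> {..<n}" by auto
    moreover have "c k \<inter> {..<n} = c l \<inter> {..<n}"
      using less.IH[OF _ k(1) less.prems(1)] by auto
    ultimately show ?thesis
      using coded_less_of_first_difference(2)[OF pos[OF k(1)], of "c k - {n}" n "c k"] k
        c[OF k(1)] partial_coded_cong[of "c k" n "c l" k] by simp
  qed
  have ne: "x \<noteq> ?g k" if "k \<in> {a..b}" for k
    using below[OF that] above[OF that] by fastforce
  have conn: "connected (?g ` {a..b})"
    unfolding partial_coded_def by (intro connected_continuous_image continuous_intros) auto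
  have no: False if "k \<in> {a..b}" "k' \<in> {a..b}" "n \<in> c k" "n \<notin> c k'" for k k'
  proof -
    have "?g k \<le> x" "x \<le> ?g k'" using above[of k] below[of k'] that by auto
    then have "x \<in> ?g ` {a..b}"
      using connectedD_interval[OF conn imageI[OF that(1)] imageI[OF that(2)]] by blast
    then show False using ne by blast
  qed
  show ?case using no less.prems by blast
qed

lemma interior_Lambda:
  assumes x: "0 < x" "x < 1/2"
  shows "interior (Lambda x) = {}"
proof (rule ccontr)
  assume "interior (Lambda x) \<noteq> {}"
  then obtain p e where e: "0 < e" "ball p e \<subseteq> Lambda x"
    by (meson ex_in_conv mem_interior)
  then have "p \<in> Lambda x" using centre_in_ball[of p e] by blast
  then have p: "p \<le> 1/2" by (simp add: Lambda_iff_coded)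
  \<comment> \<open>An interval to the left of \<open>p\<close> avoids the parameter \<open>1/2\<close>, where there are no gaps.\<close>
  define a b where "a = p - e / 2" and "b = p - e / 4"
  have "{a..b} \<subseteq> ball p e" using e(1) by (auto simp: a_def b_def dist_real_def)
  then have sub: "{a..b} \<subseteq> Lambda x" using e(2) by blast
  have "a < b" "b < 1/2" using e(1) p by (auto simp: a_def b_def)
  then have "0 < a" using sub by (force simp: Lambda_iff_coded)
  have "\<forall>l\<in>{a..b}. \<exists>A. coded A l = x" using sub by (auto simp: Lambda_iff_coded)
  then obtain c where c: "\<And>l. l \<in> {a..b} \<Longrightarrow> coded (c l) l = x" by metis
  have ab: "a \<in> {a..b}" "b \<in> {a..b}" using \<open>a < b\<close> by auto
  have "c a = c b"
    using digits_constant_on_interval[OF \<open>0 < a\<close> \<open>b < 1/2\<close> c ab] by auto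
  moreover have "coded (c a) a < coded (c a) b"
    using coded_strict_mono[of a b "c a"] first_digit_zero[of a "c a"] nonempty_code[of "c a" a]
      c[OF ab(1)] \<open>0 < a\<close> \<open>a < b\<close> \<open>b < 1/2\<close> x by auto
  ultimately show False using c[OF ab(1)] c[OF ab(2)] by simp
qed

theorem theorem1p1:
  fixes x :: real
  assumes "0 < x" and "x < 1/2"
  shows "cantor_set (Lambda x)
    \<and> (x \<in> Lambda x \<and> (\<forall>l\<in>Lambda x. x \<le> l))
    \<and> (1/2 \<in> Lambda x \<and> (\<forall>l\<in>Lambda x. l \<le> 1/2))"
proof -
  have "cantor_set (Lambda x)"
    unfolding cantor_set_def
    using self_in_Lambda[OF assms] compact_Lambda[OF assms] interior_Lambda[OF assms]
      Lambda_no_isolated[OF assms] by blast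
  then show ?thesis
    using self_in_Lambda[OF assms] half_in_Lambda[OF assms] Lambda_lower_bound[OF assms(2)]
    by (auto simp: Lambda_def)
qed

end
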